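(* Let $p\in\mathbb{R}[x_1,\dots,x_n]$ be a polynomial with support $S(p)$, let $V$ be the set of vertices of the half Newton polytope $\tfrac12N(p)$, and let $B$ be any SOS basis of $p$. Then $$\{u\in V : u^2\in S(p)\}\subseteq B,$$ that is, every monomial $u=\mathbf{x}^{\alpha}$ whose exponent vector $\alpha\in\mathbb{Z}_{\ge0}^n$ is a vertex of $\tfrac12N(p)$ and which satisfies $u^2\in S(p)$ belongs to $B$.
   Context: $S(p)$ is the set of monomials appearing in $p$ with nonzero coefficient. The Newton polytope $N(p)\subset\mathbb{R}^n$ is the convex hull of the exponent vectors of the monomials in $S(p)$, and the half Newton polytope $\tfrac12N(p)$ is $N(p)$ scaled by $1/2$ about the origin. Monomials are identified with their exponent vectors. For a finite set $B$ of monomials, $\mathbf{z}_B(\mathbf{x})$ denotes the vector of the monomials in $B$. $B$ is an SOS basis of $p$ if there is a positive semidefinite real symmetric matrix $Q$ with $p(\mathbf{x})=\mathbf{z}_B(\mathbf{x})^\top Q\,\mathbf{z}_B(\mathbf{x})$. *)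

theory Defs
  imports "HOL-Analysis.Analysis" "HOL-Library.Poly_Mapping"
begin

text \<open>
  A monomial in variables indexed by the finite type \<open>'n\<close> is identified with its exponent
  function, so the product of monomials is the sum of exponent functions and \<open>u\<^sup>2\<close> is \<open>u + u\<close>.
  A polynomial maps monomials to coefficients; its support is \<^const>\<open>Poly_Mapping.keys\<close>,
  and \<open>+\<close>, \<open>*\<close> are the ring operations (convolution) provided for \<^type>\<open>poly_mapping\<close>.
\<close>

type_synonym 'n monomial = "'n \<Rightarrow>\<^sub>0 nat"
type_synonym 'n mpoly = "'n monomial \<Rightarrow>\<^sub>0 real"

definition exponent_vector :: "'n::finite monomial \<Rightarrow> real ^ 'n" where
  "exponent_vector u = (\<chi> i. real (Poly_Mapping.lookup u i))"

definition newton_polytope :: "'n::finite mpoly \<Rightarrow> (real ^ 'n) set" where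
  "newton_polytope p = convex hull (exponent_vector ` Poly_Mapping.keys p)"

definition half_newton_polytope :: "'n::finite mpoly \<Rightarrow> (real ^ 'n) set" where
  "half_newton_polytope p = (\<lambda>x. (1/2) *\<^sub>R x) ` newton_polytope p"

definition vertices :: "'a::real_vector set \<Rightarrow> 'a set" where
  "vertices P = {v. v extreme_point_of P}"

definition monom_poly :: "'n monomial \<Rightarrow> 'n mpoly" where
  "monom_poly u = Poly_Mapping.single u 1"

definition const_poly :: "real \<Rightarrow> 'n mpoly" where
  "const_poly c = Poly_Mapping.single 0 c"

text \<open>
  Real matrices with rows and columns indexed by a finite set \<open>B\<close> are functions of two
  arguments, of which only the values on \<open>B \<times> B\<close> are relevant.
\<close>

definition psd_on :: "'b set \<Rightarrow> ('b \<Rightarrow> 'b \<Rightarrow> real) \<Rightarrow> bool" where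
  "psd_on B Q \<longleftrightarrow>
     (\<forall>a\<in>B. \<forall>b\<in>B. Q a b = Q b a) \<and>
     (\<forall>v :: 'b \<Rightarrow> real. 0 \<le> (\<Sum>a\<in>B. \<Sum>b\<in>B. v a * Q a b * v b))"

definition sos_basis :: "'n::finite mpoly \<Rightarrow> 'n monomial set \<Rightarrow> bool" where
  "sos_basis p B \<longleftrightarrow> finite B \<and>
     (\<exists>Q. psd_on B Q \<and>
          p = (\<Sum>a\<in>B. \<Sum>b\<in>B. monom_poly a * const_poly (Q a b) * monom_poly b))"

end

theory Submission
  imports Defs
begin

text \<open>
  Let \<open>B'\<close> be the set of \<open>a \<in> B\<close> with \<open>Q a a \<noteq> 0\<close>; by positive semidefiniteness only products of
  elements of \<open>B'\<close> contribute to \<open>p\<close>. If \<open>w\<close> is a vertex of the convex hull of \<open>B'\<close>, then \<open>w + w\<close>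
  is a sum of two elements of \<open>B'\<close> in only one way, so its coefficient is \<open>Q w w \<noteq> 0\<close>, and \<open>w\<close> lies
  in the half Newton polytope; hence so does all of \<open>B'\<close>. A vertex \<open>u\<close> of the half Newton polytope
  with \<open>u + u\<close> in the support is the midpoint of two elements of \<open>B'\<close>, which therefore equal \<open>u\<close>.
\<close>

lemma exponent_vector_add: "exponent_vector (a + b) = exponent_vector a + exponent_vector b"
  by (simp add: exponent_vector_def vec_eq_iff lookup_add)

lemma exponent_vector_eq_iff: "exponent_vector a = exponent_vector b \<longleftrightarrow> a = b"
  by (auto simp: exponent_vector_def vec_eq_iff intro: poly_mapping_eqI)

text \<open>The hypothesis makes \<open>x\<close> the midpoint of \<open>a\<close> and
  \<open>b\<close>, and a midpoint lies in the open segment unless the endpoints coincide.\<close>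

lemma extreme_point_of_midpointD:
  assumes "x extreme_point_of S" "a \<in> S" "b \<in> S" "a + b = x + x"
  shows "a = x \<and> b = x"
proof -
  have x: "x = midpoint a b"
    using assms(4) by (simp add: midpoint_def flip: scaleR_2)
  have "x \<notin> open_segment a b"
    using assms(1-3) by (simp add: extreme_point_of_def)
  then have "a = b"
    unfolding x by simp
  with x show ?thesis by simp
qed

lemma exponent_vector_midpointD:
  assumes "exponent_vector w extreme_point_of S"
    and "exponent_vector a \<in> S" "exponent_vector b \<in> S" "a + b = w + w"
  shows "a = w \<and> b = w"
  using extreme_point_of_midpointD[OF assms(1-3)] assms(4)
  by (metis exponent_vector_add exponent_vector_eq_iff)

lemma exponent_vector_in_half_newton_polytope:
  assumes "u + u \<in> Poly_Mapping.keys p"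
  shows "exponent_vector u \<in> half_newton_polytope p"
proof -
  have "exponent_vector (u + u) \<in> newton_polytope p"
    using assms by (simp add: newton_polytope_def hull_inc)
  moreover have "exponent_vector u = (1/2) *\<^sub>R exponent_vector (u + u)"
    by (simp add: exponent_vector_add flip: scaleR_2)
  ultimately show ?thesis
    unfolding half_newton_polytope_def by blast
qed

lemma convex_half_newton_polytope: "convex (half_newton_polytope p)"
  by (simp add: half_newton_polytope_def newton_polytope_def convex_scaling)

text \<open>On the vector with value \<open>t\<close> at \<open>a\<close>, 1 at \<open>b\<close> and
  0 elsewhere, the quadratic form is affine in \<open>t\<close> with slope \<open>2 * Q a b\<close>,
  so a nonzero slope would make it negative somewhere.\<close>

lemma psd_on_diag_eq_0:
  assumes "psd_on B Q" "finite B" "a \<in> B" "b \<in> B" "Q a a = 0"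
  shows "Q a b = 0"
proof (rule ccontr)
  assume nz: "Q a b \<noteq> 0"
  with assms have "a \<noteq> b" by auto
  \<comment> \<open>Solves \<open>2 * t * Q a b + Q b b = - 1\<close>.\<close>
  define t where "t = - (Q b b + 1) / (2 * Q a b)"
  define v where "v = (\<lambda>x. if x = a then t else if x = b then 1 else (0::real))"
  have sym: "Q b a = Q a b"
    using assms by (simp add: psd_on_def)
  have restrict: "(\<Sum>x\<in>B. v x * f x) = t * f a + f b" for f
  proof -
    have "(\<Sum>x\<in>B. v x * f x) = (\<Sum>x\<in>{a, b}. v x * f x)"
      by (rule sum.mono_neutral_right) (use assms in \<open>auto simp: v_def\<close>)
    with \<open>a \<noteq> b\<close> show ?thesis by (simp add: v_def)
  qed
  have "(\<Sum>x\<in>B. \<Sum>y\<in>B. v x * Q x y * v y) = (\<Sum>x\<in>B. v x * (\<Sum>y\<in>B. v y * Q x y))"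
    by (simp add: sum_distrib_left mult_ac)
  also have "\<dots> = 2 * t * Q a b + Q b b"
    by (simp add: restrict sym assms(5))
  also have "\<dots> = - 1"
    using nz by (simp add: t_def field_simps)
  finally show False
    using assms(1) by (auto simp: psd_on_def dest: spec[of _ v])
qed

lemma lookup_gram_polynomial:
  "Poly_Mapping.lookup (\<Sum>a\<in>B. \<Sum>b\<in>B. monom_poly a * const_poly (Q a b) * monom_poly b) m
    = (\<Sum>a\<in>B. \<Sum>b\<in>B. if a + b = m then Q a b else 0)"
  by (simp add: lookup_sum monom_poly_def const_poly_def mult_single lookup_single when_def)

theorem lemma7:
  fixes p :: "'n::finite mpoly" and B :: "'n monomial set"
  assumes "sos_basis p B"
  shows "{u. exponent_vector u \<in> vertices (half_newton_polytope p) \<and>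
             u + u \<in> Poly_Mapping.keys p} \<subseteq> B"
proof -
  obtain Q where fin: "finite B" and psd: "psd_on B Q"
    and p: "p = (\<Sum>a\<in>B. \<Sum>b\<in>B. monom_poly a * const_poly (Q a b) * monom_poly b)"
    using assms by (auto simp: sos_basis_def)
  define B' where "B' = {a \<in> B. Q a a \<noteq> 0}"
  let ?H = "convex hull (exponent_vector ` B')"
  have coeff: "Poly_Mapping.lookup p m = (\<Sum>a\<in>B. \<Sum>b\<in>B. if a + b = m then Q a b else 0)" for m
    unfolding p by (rule lookup_gram_polynomial)
  have supp: "a \<in> B' \<and> b \<in> B'" if "a \<in> B" "b \<in> B" "Q a b \<noteq> 0" for a b
  proof -
    \<comment> \<open>Symmetry turns the vanishing of row \<open>b\<close> into that of column
      \<open>b\<close>, which is what \<open>b \<in> B'\<close> needs.\<close>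
    have "Q b a = Q a b"
      using psd that by (simp add: psd_on_def)
    then show ?thesis
      using that psd_on_diag_eq_0[OF psd fin, of a b] psd_on_diag_eq_0[OF psd fin, of b a]
      by (auto simp: B'_def)
  qed
  have vertex: "exponent_vector w \<in> half_newton_polytope p"
    if w: "w \<in> B'" and ext: "exponent_vector w extreme_point_of ?H" for w
  proof -
    have eq: "a = w \<and> b = w" if "a \<in> B" "b \<in> B" "a + b = w + w" "Q a b \<noteq> 0" for a b
      using exponent_vector_midpointD[OF ext _ _ that(3)] supp[OF that(1,2,4)]
      by (simp add: hull_inc)
    \<comment> \<open>The test on \<open>b\<close> stands outermost so that the inner sum collapses
      first, then the outer one. By \<open>eq\<close>, every pair other than \<open>(w, w)\<close>
      contributes 0.\<close>
    have "Poly_Mapping.lookup p (w + w)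
        = (\<Sum>a\<in>B. \<Sum>b\<in>B. if b = w then (if a = w then Q w w else 0) else 0)"
      unfolding coeff
    proof (intro sum.cong refl)
      fix a b
      assume "a \<in> B" "b \<in> B"
      then show "(if a + b = w + w then Q a b else 0)
          = (if b = w then (if a = w then Q w w else 0) else 0)"
        using eq[of a b] by metis
    qed
    also have "\<dots> = Q w w"
      using w fin by (simp add: B'_def)
    finally have "w + w \<in> Poly_Mapping.keys p"
      using w by (simp add: B'_def in_keys_iff)
    then show ?thesis
      by (rule exponent_vector_in_half_newton_polytope)
  qed
  have "?H = convex hull {x. x extreme_point_of ?H}"
    using fin by (intro Krein_Milman_polytope) (simp add: B'_def)
  also have "\<dots> \<subseteq> half_newton_polytope p"
    \<comment> \<open>Extreme points of the hull are among its generators, so each is the exponent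
      vector of some \<open>w \<in> B'\<close> and \<open>vertex\<close> applies.\<close>
    using vertex extreme_point_of_convex_hull
    by (intro hull_minimal convex_half_newton_polytope) blast
  finally have sub: "exponent_vector a \<in> half_newton_polytope p" if "a \<in> B'" for a
    using that by (meson hull_inc imageI subsetD)
  show ?thesis
  proof safe
    fix u
    assume "exponent_vector u \<in> vertices (half_newton_polytope p)"
      and key: "u + u \<in> Poly_Mapping.keys p"
    then have ext: "exponent_vector u extreme_point_of half_newton_polytope p"
      by (simp add: vertices_def)
    \<comment> \<open>A nonzero coefficient forces a nonzero term, which supplies the pair
      \<open>a\<close>, \<open>b\<close>.\<close>
    have "(\<Sum>a\<in>B. \<Sum>b\<in>B. if a + b = u + u then Q a b else 0) \<noteq> 0"
      using key by (simp add: in_keys_iff coeff)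
    then obtain a where a: "a \<in> B" "(\<Sum>b\<in>B. if a + b = u + u then Q a b else 0) \<noteq> 0"
      by (rule sum.not_neutral_contains_not_neutral)
    from a(2) obtain b where "b \<in> B" "(if a + b = u + u then Q a b else 0) \<noteq> 0"
      by (rule sum.not_neutral_contains_not_neutral)
    with a(1) have ab: "a \<in> B" "b \<in> B" "a + b = u + u" "Q a b \<noteq> 0"
      by (simp_all split: if_split_asm)
    then have "a = u"
      using exponent_vector_midpointD[OF ext _ _ ab(3)] supp[OF ab(1,2,4)] sub by blast
    with ab(1) show "u \<in> B" by simp
  qed
qed

end
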